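(* Let $G$ be a connected circle graph with $n$ vertices, where $n\geq 2$. Then \[P_G^{\times}(z)=a_1z+a_2z^2+\cdots+a_nz^n \quad\text{with } a_i\neq 0 \text{ for all } 1\leq i\leq n\] if and only if $G$ is a complete graph.
   Context: A ribbon graph $G$ is a surface with boundary formed from vertex discs and edge discs (ribbons), each edge attached to vertex discs along two disjoint arcs; $v,e,f,c$ denote the numbers of vertices, edges, boundary components and connected components, and the Euler genus is $\varepsilon=2c-v+e-f$. For $A\subseteq E(G)$, the partial Petrial $G^{\times|A}$ is obtained by adding a half-twist to each edge in $A$, and ${^\partial\varepsilon^{\times}_{G}(z)}=\sum_{A\subseteq E(G)} z^{\varepsilon(G^{\times|A})}$. A bouquet is a ribbon graph with one vertex; two loops are interlaced if their ends alternate around the vertex boundary; the intersection graph $I(B)$ of a bouquet $B$ has vertex set $E(B)$ with adjacency meaning interlaced. A circle graph is a graph of the form $I(B)$ for some bouquet $B$. For a circle graph $G$, $P_G^{\times}(z):={^\partial\varepsilon^{\times}_{B}(z)}$ where $B$ is any bouquet with $I(B)=G$ (this does not depend on the choice of $B$). *)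

theory Defs
  imports "HOL-Computational_Algebra.Polynomial" "Graph_Theory.Graph_Theory"
begin

text \<open>
  Ribbon graphs are encoded, as usual, by signed rotation systems.  Every edge disc \<open>e\<close> is a
  ribbon attached to vertex discs along two arcs, its ends \<open>(e, False)\<close> and \<open>(e, True)\<close>.
  Each vertex disc is given an orientation, and \<open>rg_rot G v\<close> lists the ends on the
  boundary circle of the disc \<open>v\<close> in the resulting cyclic order (starting anywhere).  An edge belongs to
  \<open>rg_twisted G\<close> iff its ribbon is half-twisted relative to the chosen orientations of the
  vertex discs.  Isolated vertices have the empty list.
\<close>

record ('v, 'e) ribbon_graph =
  rg_verts :: "'v set"
  rg_edges :: "'e set"
  rg_rot :: "'v \<Rightarrow> ('e \<times> bool) list"
  rg_twisted :: "'e set"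

definition is_ribbon_graph :: "('v, 'e) ribbon_graph \<Rightarrow> bool" where
  "is_ribbon_graph G \<longleftrightarrow>
     finite (rg_verts G) \<and> finite (rg_edges G) \<and> rg_twisted G \<subseteq> rg_edges G \<and>
     (\<forall>v\<in>rg_verts G. distinct (rg_rot G v)) \<and>
     (\<forall>v\<in>rg_verts G. \<forall>w\<in>rg_verts G. v \<noteq> w \<longrightarrow> set (rg_rot G v) \<inter> set (rg_rot G w) = {}) \<and>
     (\<Union>v\<in>rg_verts G. set (rg_rot G v)) = rg_edges G \<times> UNIV"

definition rg_adj :: "('v, 'e) ribbon_graph \<Rightarrow> 'v rel" where
  "rg_adj G = {(v, w). v \<in> rg_verts G \<and> w \<in> rg_verts G \<and>
     (\<exists>e h. (e, h) \<in> set (rg_rot G v) \<and> (e, \<not> h) \<in> set (rg_rot G w))}"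

definition num_components :: "('v, 'e) ribbon_graph \<Rightarrow> nat" where
  "num_components G = card (rg_verts G // (rg_adj G)\<^sup>*)"

text \<open>
  The end \<open>x\<close> of a ribbon is an arc with two endpoints, the corners \<open>(x, False)\<close> and
  \<open>(x, True)\<close>, where \<open>(x, False)\<close> comes first in the orientation of the vertex disc.
  The boundary of the surface consists of the arcs of the vertex circles between consecutive ends
  and of the two sides of every ribbon that run from one end to the other, together with
  the full boundary circles of the isolated vertices.  In an untwisted ribbon
  each side joins a first corner to a second corner.
\<close>

definition corners :: "('v, 'e) ribbon_graph \<Rightarrow> (('e \<times> bool) \<times> bool) set" where
  "corners G = (rg_edges G \<times> UNIV) \<times> UNIV"

definition vertex_arcs :: "('v, 'e) ribbon_graph \<Rightarrow> (('e \<times> bool) \<times> bool) rel" where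
  "vertex_arcs G = {((rg_rot G v ! i, True), (rg_rot G v ! (Suc i mod length (rg_rot G v)), False)) | v i.
     v \<in> rg_verts G \<and> i < length (rg_rot G v)}"

definition ribbon_sides :: "('v, 'e) ribbon_graph \<Rightarrow> (('e \<times> bool) \<times> bool) rel" where
  "ribbon_sides G = {(((e, h), s), ((e, \<not> h), if e \<in> rg_twisted G then s else \<not> s)) | e h s.
     e \<in> rg_edges G}"

definition num_boundary_components :: "('v, 'e) ribbon_graph \<Rightarrow> nat" where
  "num_boundary_components G =
     card (corners G // (vertex_arcs G \<union> (vertex_arcs G)\<inverse> \<union> ribbon_sides G)\<^sup>*)
     + card {v \<in> rg_verts G. rg_rot G v = []}"

definition euler_genus :: "('v, 'e) ribbon_graph \<Rightarrow> int" where
  "euler_genus G = 2 * int (num_components G) - int (card (rg_verts G)) + int (card (rg_edges G))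
     - int (num_boundary_components G)"

definition partial_petrial :: "('v, 'e) ribbon_graph \<Rightarrow> 'e set \<Rightarrow> ('v, 'e) ribbon_graph" where
  "partial_petrial G A = G\<lparr>rg_twisted := (rg_twisted G - A) \<union> (A - rg_twisted G)\<rparr>"

text \<open>The Euler genus of a ribbon graph is nonnegative, so \<open>nat\<close> does not truncate here.\<close>

definition partial_petrial_poly :: "('v, 'e) ribbon_graph \<Rightarrow> int poly" where
  "partial_petrial_poly G = (\<Sum>A\<in>Pow (rg_edges G). monom 1 (nat (euler_genus (partial_petrial G A))))"

definition bouquet :: "('v, 'e) ribbon_graph \<Rightarrow> bool" where
  "bouquet B \<longleftrightarrow> is_ribbon_graph B \<and> card (rg_verts B) = 1"

text \<open>The ends of the two loops occur in the cyclic order \<open>e f e f\<close>.  In a list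
  representing the cyclic order, this appears as \<open>e f e f\<close> or as \<open>f e f e\<close>.\<close>

definition interlaced :: "('v, 'e) ribbon_graph \<Rightarrow> 'e \<Rightarrow> 'e \<Rightarrow> bool" where
  "interlaced B e f \<longleftrightarrow>
     (\<exists>v\<in>rg_verts B. \<exists>i j k l. i < j \<and> j < k \<and> k < l \<and> l < length (rg_rot B v) \<and>
        map (\<lambda>m. fst (rg_rot B v ! m)) [i, j, k, l] \<in> {[e, f, e, f], [f, e, f, e]})"

definition intersection_graph :: "('v, 'e) ribbon_graph \<Rightarrow> 'e pair_pre_digraph" where
  "intersection_graph B = \<lparr>pverts = rg_edges B, parcs = {(e, f). interlaced B e f}\<rparr>"

text \<open>Bouquets have a single vertex, so fixing the type of its name is no restriction; the edges of
  the bouquet can be named by the vertices of the graph, so equality can be required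
  instead of isomorphism.\<close>

definition represents :: "(nat, 'a) ribbon_graph \<Rightarrow> 'a pair_pre_digraph \<Rightarrow> bool" where
  "represents B G \<longleftrightarrow> bouquet B \<and> intersection_graph B = G"

definition circle_graph :: "'a pair_pre_digraph \<Rightarrow> bool" where
  "circle_graph G \<longleftrightarrow> (\<exists>B. represents B G)"

text \<open>The polynomial does not depend on the choice of the bouquet.\<close>

definition circle_graph_poly :: "'a pair_pre_digraph \<Rightarrow> int poly" where
  "circle_graph_poly G = partial_petrial_poly (SOME B. represents B G)"

end

theory Submission
  imports Defs "HOL-Library.Z2"
begin

text \<open>
  Colour the boundary components of a bouquet with elements of \<open>GF(2)\<close>.  The two sides of a ribbon
  differ in colour by some \<open>X e\<close>, and this jump is the same at both ends of \<open>e\<close>.  Going around the vertex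
  recovers the colouring from \<open>X\<close> and one colour, and the two sides of \<open>e\<close> are coloured
  consistently iff the row of \<open>e\<close> in \<open>A + D\<close> annihilates \<open>X\<close>, where \<open>A\<close> is the
  adjacency matrix of the intersection graph and the diagonal \<open>D\<close> marks the twisted loops.  So
  \<open>f = 1 + dim ker (A + D)\<close> and the Euler genus is the rank of \<open>A + D\<close>.  A partial Petrial changes
  \<open>D\<close> arbitrarily.

  For a complete graph with \<open>k \<ge> 1\<close> twisted loops the rank is \<open>n - k + 1\<close>, which takes all values
  in \<open>1, \<dots>, n\<close>, and \<open>A \<noteq> 0\<close> excludes rank 0.  A connected graph that is not complete has an
  induced path \<open>u v w\<close>; the rows of \<open>u\<close> and \<open>v\<close> are then independent for every \<open>D\<close>, so rank 1 does not occur.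
\<close>

section \<open>Arithmetic in GF(2), with addition on \<open>bit\<close> kept in ring form rather
  than rewritten to XOR\<close>

declare add_bit_eq_xor [simp del] mult_bit_eq_and [simp del]

lemma bit_add_self [simp]: "x + x = (0::bit)"
  by (cases x) simp_all

lemma bit_add_self_left [simp]: "x + (x + y) = (y::bit)"
  by (simp flip: add.assoc)

lemma bit_add_eq_0_iff [simp]: "x + y = 0 \<longleftrightarrow> x = (y::bit)"
  by (cases x; cases y) simp_all


subsection \<open>Colourings and equivalence classes\<close>

text \<open>Fixing the value 0 outside \<open>S\<close> gives each colouring of \<open>S\<close>
  exactly one representative, so cardinalities can be compared.\<close>

definition colourings :: "'a set \<Rightarrow> 'a rel \<Rightarrow> ('a \<Rightarrow> bit) set" where
  "colourings S r = {c. (\<forall>x. x \<notin> S \<longrightarrow> c x = 0) \<and> (\<forall>(x, y)\<in>r. c x = c y)}"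

lemma colourings_rtrancl:
  assumes "c \<in> colourings S r" and "(x, y) \<in> r\<^sup>*"
  shows "c x = c y"
  using assms(2) by induction (use assms(1) in \<open>auto simp: colourings_def\<close>)

text \<open>A colouring is constant on each class of \<open>r\<^sup>*\<close> and the values on
  different classes are free. This turns counting boundary components into counting solutions over
  GF(2).\<close>

lemma card_colourings:
  assumes fin: "finite S" and sub: "r \<subseteq> S \<times> S" and sym: "sym r"
  shows "card (colourings S r) = 2 ^ card (S // r\<^sup>*)"
proof -
  have closed: "r\<^sup>* `` {x} \<subseteq> S" if "x \<in> S" for x
  proof
    fix y assume "y \<in> r\<^sup>* `` {x}"
    then have "(x, y) \<in> r\<^sup>*" by simp
    then show "y \<in> S" by induction (use that sub in auto)
  qed
  have sym': "sym (r\<^sup>*)" using sym by (rule sym_rtrancl)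
  have eq: "r\<^sup>* `` {x} = r\<^sup>* `` {y}" if "(x, y) \<in> r\<^sup>*" for x y
    using that sym' by (auto dest: symD intro: rtrancl_trans)
  \<comment> \<open>A colouring corresponds to the set of classes on which it is 1; the inverse
    sends a set of classes to the indicator of its union.\<close>
  define F :: "('a \<Rightarrow> bit) \<Rightarrow> 'a set set" where "F c = {r\<^sup>* `` {x} | x. x \<in> S \<and> c x = 1}" for c
  have "bij_betw F (colourings S r) (Pow (S // r\<^sup>*))"
  proof (rule bij_betw_byWitness[where f' = "\<lambda>Q x. of_bool (x \<in> \<Union>Q)"])
    show "\<forall>c\<in>colourings S r. (\<lambda>x. of_bool (x \<in> \<Union>(F c))) = c"
    proof
      fix c assume c: "c \<in> colourings S r"
      have "x \<in> \<Union>(F c) \<longleftrightarrow> c x = 1" for x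
      proof
        assume "x \<in> \<Union>(F c)"
        then obtain y where "c y = 1" "(y, x) \<in> r\<^sup>*" by (auto simp: F_def)
        then show "c x = 1" using colourings_rtrancl[OF c] by metis
      next
        assume "c x = 1"
        moreover have "x \<in> S" using c \<open>c x = 1\<close> by (force simp: colourings_def)
        ultimately show "x \<in> \<Union>(F c)" by (auto simp: F_def)
      qed
      then show "(\<lambda>x. of_bool (x \<in> \<Union>(F c))) = c"
        by (auto simp: fun_eq_iff of_bool_def)
    qed
    show "\<forall>Q\<in>Pow (S // r\<^sup>*). F (\<lambda>x. of_bool (x \<in> \<Union>Q)) = Q"
    proof
      fix Q assume Q: "Q \<in> Pow (S // r\<^sup>*)"
      have "r\<^sup>* `` {x} \<in> Q \<longleftrightarrow> x \<in> \<Union>Q" if "x \<in> S" for x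
      proof
        assume "x \<in> \<Union>Q"
        then obtain q where "q \<in> Q" "x \<in> q" by auto
        moreover obtain y where "q = r\<^sup>* `` {y}"
          using Q \<open>q \<in> Q\<close> by (auto elim!: quotientE)
        ultimately show "r\<^sup>* `` {x} \<in> Q" using eq[of y x] by auto
      qed auto
      then have "F (\<lambda>x. of_bool (x \<in> \<Union>Q)) = {r\<^sup>* `` {x} | x. x \<in> S \<and> r\<^sup>* `` {x} \<in> Q}"
        unfolding F_def of_bool_eq_1_iff by blast
      also have "\<dots> = Q"
        using Q unfolding quotient_def by blast
      finally show "F (\<lambda>x. of_bool (x \<in> \<Union>Q)) = Q" .
    qed
    show "F ` colourings S r \<subseteq> Pow (S // r\<^sup>*)"
      by (auto simp: F_def quotient_def)
    show "(\<lambda>Q x. of_bool (x \<in> \<Union>Q)) ` Pow (S // r\<^sup>*) \<subseteq> colourings S r"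
    proof clarify
      fix Q assume Q: "Q \<subseteq> S // r\<^sup>*"
      have "x \<in> S" if "x \<in> \<Union>Q" for x
        using that Q closed by (auto simp: quotient_def)
      moreover have "x \<in> \<Union>Q \<longleftrightarrow> y \<in> \<Union>Q" if "(x, y) \<in> r" for x y
      proof -
        have "x \<in> q \<longleftrightarrow> y \<in> q" if "q \<in> Q" for q
        proof -
          obtain z where "q = r\<^sup>* `` {z}" using \<open>q \<in> Q\<close> Q by (auto elim!: quotientE)
          then show ?thesis
            using \<open>(x, y) \<in> r\<close> sym by (auto dest: symD intro: rtrancl_into_rtrancl)
        qed
        then show ?thesis by blast
      qed
      ultimately show "(\<lambda>x. of_bool (x \<in> \<Union>Q)) \<in> colourings S r"
        by (auto simp: colourings_def)
    qed
  qed
  then have "card (colourings S r) = card (Pow (S // r\<^sup>*))"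
    by (rule bij_betw_same_card)
  moreover have "finite (S // r\<^sup>*)"
    using fin by (simp add: quotient_def)
  ultimately show ?thesis by (simp add: card_Pow)
qed


subsection \<open>The kernel of the adjacency matrix with twists on the diagonal\<close>

text \<open>The kernel of \<open>A + D\<close> over GF(2): \<open>A\<close> is the matrix of
  \<open>I\<close>, and \<open>D\<close> has a 1 on the diagonal exactly at \<open>T\<close>. Below,
  the cardinality \<open>2 ^ k\<close> plays the role of the dimension \<open>k\<close>.\<close>

definition twisted_kernel :: "'e set \<Rightarrow> ('e \<Rightarrow> 'e \<Rightarrow> bool) \<Rightarrow> 'e set \<Rightarrow> ('e \<Rightarrow> bit) set" where
  "twisted_kernel E I T = {X. (\<forall>e. e \<notin> E \<longrightarrow> X e = 0) \<and>
     (\<forall>e\<in>E. (\<Sum>f | f \<in> E \<and> I e f. X f) + (if e \<in> T then X e else 0) = 0)}"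

lemma twisted_kernel_add:
  assumes "X \<in> twisted_kernel E I T" and "Y \<in> twisted_kernel E I T"
  shows "(\<lambda>e. X e + Y e) \<in> twisted_kernel E I T"
proof -
  have "(\<Sum>f | f \<in> E \<and> I e f. X f + Y f) + (if e \<in> T then X e + Y e else 0) =
      ((\<Sum>f | f \<in> E \<and> I e f. X f) + (if e \<in> T then X e else 0)) +
      ((\<Sum>f | f \<in> E \<and> I e f. Y f) + (if e \<in> T then Y e else 0))" for e
    by (simp add: sum.distrib ac_simps)
  then show ?thesis
    using assms unfolding twisted_kernel_def by (simp del: bit_add_eq_0_iff)
qed

text \<open>Two kernel vectors that agree on \<open>F\<close> have a difference, which is their sum
  in characteristic 2, vanishing on \<open>F\<close>. So restriction to \<open>F\<close> is
  injective, and the rank is at least \<open>card E - card F\<close>.\<close>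

lemma card_twisted_kernel_le:
  assumes "finite F"
    and inj: "\<And>X. X \<in> twisted_kernel E I T \<Longrightarrow> (\<And>e. e \<in> F \<Longrightarrow> X e = 0) \<Longrightarrow> X = (\<lambda>_. 0)"
  shows "card (twisted_kernel E I T) \<le> 2 ^ card F"
proof -
  have "inj_on (\<lambda>X. {e\<in>F. X e = 1}) (twisted_kernel E I T)"
  proof (rule inj_onI)
    fix X Y
    assume XY: "X \<in> twisted_kernel E I T" "Y \<in> twisted_kernel E I T"
      and eq: "{e\<in>F. X e = 1} = {e\<in>F. Y e = 1}"
    have "X e + Y e = 0" if "e \<in> F" for e
    proof -
      have "X e = 1 \<longleftrightarrow> Y e = 1" using that eq by blast
      then show ?thesis by (cases "X e"; cases "Y e") auto
    qed
    then have "(\<lambda>e. X e + Y e) = (\<lambda>_. 0)"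
      using inj[OF twisted_kernel_add[OF XY]] by blast
    then show "X = Y" by (simp add: fun_eq_iff)
  qed
  then have "card (twisted_kernel E I T) \<le> card (Pow F)"
    by (rule card_inj_on_le) (use assms(1) in auto)
  then show ?thesis using assms(1) by (simp add: card_Pow)
qed

text \<open>Rank at least 1: if \<open>X\<close> vanishes off \<open>v\<close>, row \<open>u\<close>
  reads \<open>X v = 0\<close> for every diagonal, because a diagonal term there multiplies
  \<open>X u = 0\<close>.\<close>

lemma card_twisted_kernel_adjacent:
  assumes "finite E" and "u \<in> E" "v \<in> E" "u \<noteq> v" "I u v"
  shows "card (twisted_kernel E I T) \<le> 2 ^ (card E - 1)"
proof -
  have "card (twisted_kernel E I T) \<le> 2 ^ card (E - {v})"
  proof (rule card_twisted_kernel_le)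
    fix X assume X: "X \<in> twisted_kernel E I T" and zero: "\<And>e. e \<in> E - {v} \<Longrightarrow> X e = 0"
    have "(\<Sum>f | f \<in> E \<and> I u f. X f) = (\<Sum>f\<in>{v}. X f)"
      using assms zero by (intro sum.mono_neutral_right) auto
    then have "X v = 0"
      using X assms zero[of u] by (auto simp: twisted_kernel_def split: if_splits)
    then show "X = (\<lambda>_. 0)"
      using X zero by (auto simp: twisted_kernel_def fun_eq_iff)
  qed (use assms in auto)
  then show ?thesis using assms by simp
qed

text \<open>Rank at least 2: on columns \<open>v\<close>, \<open>w\<close> the rows of
  \<open>u\<close> and \<open>v\<close> are triangular. Row \<open>u\<close> sees \<open>v\<close>
  but not \<open>w\<close> and gives \<open>X v = 0\<close>; this removes any diagonal term from row
  \<open>v\<close>, which then gives \<open>X w = 0\<close>.\<close>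

lemma card_twisted_kernel_induced_path:
  assumes "finite E" and "u \<in> E" "v \<in> E" "w \<in> E" and "u \<noteq> v" "v \<noteq> w" "u \<noteq> w"
    and "I u v" "I v w" "\<not> I u w" "\<not> I v v"
  shows "card (twisted_kernel E I T) \<le> 2 ^ (card E - 2)"
proof -
  have "card (twisted_kernel E I T) \<le> 2 ^ card (E - {v, w})"
  proof (rule card_twisted_kernel_le)
    fix X assume X: "X \<in> twisted_kernel E I T" and zero: "\<And>e. e \<in> E - {v, w} \<Longrightarrow> X e = 0"
    have "(\<Sum>f | f \<in> E \<and> I u f. X f) = (\<Sum>f\<in>{v}. X f)"
      using assms zero by (intro sum.mono_neutral_right) auto
    then have v: "X v = 0"
      using X assms zero[of u] by (auto simp: twisted_kernel_def split: if_splits)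
    have "(\<Sum>f | f \<in> E \<and> I v f. X f) = (\<Sum>f\<in>{w}. X f)"
      using assms zero by (intro sum.mono_neutral_right) auto
    then have "X w = 0"
      using X assms v by (auto simp: twisted_kernel_def split: if_splits)
    then show "X = (\<lambda>_. 0)"
      using X zero v by (auto simp: twisted_kernel_def fun_eq_iff)
  qed (use assms in auto)
  moreover have "card (E - {v, w}) = card E - 2"
    using assms by (simp add: card_Diff_subset)
  ultimately show ?thesis by simp
qed

text \<open>Here \<open>A\<close> is the all-ones matrix plus the identity, so row \<open>e\<close>
  reads \<open>sum X E + X e = 0\<close>, with a second \<open>X e\<close> if
  \<open>e \<in> U\<close>. A row in \<open>U\<close> forces the total to be 0, and the rows outside
  \<open>U\<close> then force \<open>X e = 0\<close>. The kernel consists of the even-weight vectors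
  supported on \<open>U\<close>.\<close>

lemma card_twisted_kernel_complete:
  assumes fin: "finite E" and "U \<subseteq> E" and "U \<noteq> {}"
    and complete: "\<And>e f. e \<in> E \<Longrightarrow> f \<in> E \<Longrightarrow> I e f \<longleftrightarrow> e \<noteq> f"
  shows "card (twisted_kernel E I U) = 2 ^ (card U - 1)"
proof -
  have finU: "finite U" using assms finite_subset by blast
  obtain u where u: "u \<in> U" using \<open>U \<noteq> {}\<close> by blast
  have row: "(\<Sum>f | f \<in> E \<and> I e f. X f) = sum X E + X e" if "e \<in> E" for e and X :: "'a \<Rightarrow> bit"
  proof -
    have "{f. f \<in> E \<and> I e f} = E - {e}" using complete that by auto
    moreover have "sum X E = X e + sum X (E - {e})"
      using fin that by (simp add: sum.remove)
    ultimately show ?thesis by (simp add: algebra_simps)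
  qed
  have mem: "X \<in> twisted_kernel E I U \<longleftrightarrow> (\<forall>e. e \<notin> U \<longrightarrow> X e = 0) \<and> sum X U = 0" for X
  proof
    assume X: "X \<in> twisted_kernel E I U"
    have eqn: "sum X E + X e + (if e \<in> U then X e else 0) = 0" if "e \<in> E" for e
      using X that row[OF that, of X] by (simp add: twisted_kernel_def)
    \<comment> \<open>In row \<open>u\<close> the diagonal term cancels the \<open>X u\<close>
      coming from \<open>row\<close>.\<close>
    have "sum X E = 0" using eqn[of u] u \<open>U \<subseteq> E\<close> by (auto simp: add.assoc)
    then have supp: "X e = 0" if "e \<notin> U" for e
      using eqn[of e] that X by (cases "e \<in> E") (auto simp: twisted_kernel_def)
    moreover have "sum X U = sum X E"
      using supp \<open>U \<subseteq> E\<close> fin by (intro sum.mono_neutral_left) auto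
    ultimately show "(\<forall>e. e \<notin> U \<longrightarrow> X e = 0) \<and> sum X U = 0"
      using \<open>sum X E = 0\<close> by simp
  next
    assume X: "(\<forall>e. e \<notin> U \<longrightarrow> X e = 0) \<and> sum X U = 0"
    moreover have "sum X U = sum X E"
      using X \<open>U \<subseteq> E\<close> fin by (intro sum.mono_neutral_left) auto
    ultimately show "X \<in> twisted_kernel E I U"
      using \<open>U \<subseteq> E\<close> by (auto simp: twisted_kernel_def row)
  qed
  have split: "sum X U = X u + sum X (U - {u})" for X :: "'a \<Rightarrow> bit"
    using finU u by (simp add: sum.remove)
  \<comment> \<open>An even-weight vector on \<open>U\<close> is free off \<open>u\<close>; its
    value at \<open>u\<close> is the parity bit of the others, which \<open>f'\<close>
    restores.\<close>
  have "bij_betw (\<lambda>X. {e\<in>U - {u}. X e = 1}) (twisted_kernel E I U) (Pow (U - {u}))"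
  proof (rule bij_betw_byWitness[where
        f' = "\<lambda>Y e. if e = u then \<Sum>f\<in>U - {u}. of_bool (f \<in> Y) else of_bool (e \<in> Y)"])
    show "\<forall>X\<in>twisted_kernel E I U. (\<lambda>e. if e = u then \<Sum>f\<in>U - {u}. of_bool (f \<in> {e\<in>U - {u}. X e = 1})
        else of_bool (e \<in> {e\<in>U - {u}. X e = 1})) = X"
    proof
      fix X assume X: "X \<in> twisted_kernel E I U"
      have "(\<Sum>f\<in>U - {u}. of_bool (f \<in> {e\<in>U - {u}. X e = 1})) = sum X (U - {u})"
        by (rule sum.cong) (auto simp: of_bool_def)
      moreover have "sum X (U - {u}) = X u" using X mem[of X] split[of X] by simp
      moreover have "of_bool (e \<in> {e\<in>U - {u}. X e = 1}) = X e" if "e \<noteq> u" for e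
        using that X mem[of X] by (cases "X e") auto
      ultimately show "(\<lambda>e. if e = u then \<Sum>f\<in>U - {u}. of_bool (f \<in> {e\<in>U - {u}. X e = 1})
        else of_bool (e \<in> {e\<in>U - {u}. X e = 1})) = X"
        by (simp add: fun_eq_iff)
    qed
    show "\<forall>Y\<in>Pow (U - {u}). {e\<in>U - {u}. (if e = u then \<Sum>f\<in>U - {u}. of_bool (f \<in> Y)
        else of_bool (e \<in> Y)) = (1::bit)} = Y"
      by auto
    show "(\<lambda>X. {e\<in>U - {u}. X e = 1}) ` twisted_kernel E I U \<subseteq> Pow (U - {u})" by auto
    show "(\<lambda>Y e. if e = u then \<Sum>f\<in>U - {u}. of_bool (f \<in> Y) else of_bool (e \<in> Y)) ` Pow (U - {u})
      \<subseteq> twisted_kernel E I U"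
    proof (rule image_subsetI)
      fix Y assume "Y \<in> Pow (U - {u})"
      moreover have "(\<Sum>e\<in>U - {u}. if e = u then b else of_bool (e \<in> Y)) = (\<Sum>e\<in>U - {u}. of_bool (e \<in> Y))"
        for b :: bit
        by (rule sum.cong) auto
      ultimately show "(\<lambda>e. if e = u then \<Sum>f\<in>U - {u}. of_bool (f \<in> Y) else of_bool (e \<in> Y))
          \<in> twisted_kernel E I U"
        using u by (subst mem, subst split) auto
    qed
  qed
  then have "card (twisted_kernel E I U) = card (Pow (U - {u}))"
    by (rule bij_betw_same_card)
  then show ?thesis using finU u by (simp add: card_Pow)
qed


subsection \<open>Bouquets\<close>

lemma interlaced_sym: "interlaced B e f \<longleftrightarrow> interlaced B f e"
  unfolding interlaced_def by (simp add: disj_commute)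

lemma interlaced_partial_petrial [simp]: "interlaced (partial_petrial B A) = interlaced B"
  by (simp add: interlaced_def partial_petrial_def fun_eq_iff)

lemma rg_edges_partial_petrial [simp]: "rg_edges (partial_petrial B A) = rg_edges B"
  by (simp add: partial_petrial_def)

lemma bouquet_partial_petrial:
  assumes "bouquet B" and "A \<subseteq> rg_edges B"
  shows "bouquet (partial_petrial B A)"
  using assms by (auto simp: bouquet_def is_ribbon_graph_def partial_petrial_def)

text \<open>A bouquet read as a double occurrence word: cutting the vertex circle at one point turns
  cyclic order into positions in \<open>R\<close>.\<close>

locale bouquet_word =
  fixes B :: "('v, 'e) ribbon_graph" and v :: 'v and R :: "('e \<times> bool) list" and E :: "'e set"
  assumes verts: "rg_verts B = {v}"
    and rot: "rg_rot B v = R"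
    and edges: "rg_edges B = E"
    and finE: "finite E"
    and dist: "distinct R"
    and setR: "set R = E \<times> UNIV"
begin

lemma length_pos:
  assumes "E \<noteq> {}"
  shows "0 < length R"
proof -
  obtain e where "e \<in> E" using assms by blast
  then have "(e, True) \<in> set R" using setR by simp
  then show ?thesis by (rule length_pos_if_in_set)
qed

text \<open>The parameter \<open>h\<close> absorbs which end comes first, so later arguments may
  assume \<open>p < q\<close>.\<close>

lemma end_positions:
  assumes "e \<in> E"
  obtains p q h where "p < q" "q < length R" "R ! p = (e, h)" "R ! q = (e, \<not> h)"
    "\<And>i. i < length R \<Longrightarrow> fst (R ! i) = e \<longleftrightarrow> i = p \<or> i = q"
proof -
  obtain a where a: "a < length R" "R ! a = (e, False)"
    using assms setR by (metis UNIV_I in_set_conv_nth mem_Times_iff fst_conv snd_conv)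
  obtain b where b: "b < length R" "R ! b = (e, True)"
    using assms setR by (metis UNIV_I in_set_conv_nth mem_Times_iff fst_conv snd_conv)
  have uniq: "fst (R ! i) = e \<longleftrightarrow> i = a \<or> i = b" if "i < length R" for i
  proof
    assume "fst (R ! i) = e"
    then have "R ! i = R ! a \<or> R ! i = R ! b"
      using a b by (cases "R ! i"; cases "snd (R ! i)") auto
    then show "i = a \<or> i = b" using a b that dist nth_eq_iff_index_eq by blast
  qed (use a b in auto)
  consider "a < b" | "b < a" using a b by (metis Pair_inject linorder_neqE_nat)
  then show ?thesis
  proof cases
    case 1
    then show ?thesis using that[of a b False] a b uniq by auto
  next
    case 2
    then show ?thesis using that[of b a True] a b uniq by auto
  qed
qed

lemma interlaced_iff:
  "interlaced B e f \<longleftrightarrow> (\<exists>i j k l. i < j \<and> j < k \<and> k < l \<and> l < length R \<and>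
     (fst (R ! i) = e \<and> fst (R ! j) = f \<and> fst (R ! k) = e \<and> fst (R ! l) = f \<or>
      fst (R ! i) = f \<and> fst (R ! j) = e \<and> fst (R ! k) = f \<and> fst (R ! l) = e))"
  by (simp add: interlaced_def verts rot)

lemma interlaced_edges:
  assumes "interlaced B e f"
  shows "e \<in> E" "f \<in> E" "e \<noteq> f"
proof -
  have mem: "fst (R ! i) \<in> E" if "i < length R" for i
    using setR nth_mem[OF that] by auto
  obtain i j k l where *: "i < j" "j < k" "k < l" "l < length R"
    "fst (R ! i) = e \<and> fst (R ! j) = f \<and> fst (R ! k) = e \<and> fst (R ! l) = f \<or>
      fst (R ! i) = f \<and> fst (R ! j) = e \<and> fst (R ! k) = f \<and> fst (R ! l) = e"
    using assms by (auto simp: interlaced_iff)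
  then show "e \<in> E" "f \<in> E" using mem[of i] mem[of j] by auto
  \<comment> \<open>For \<open>e = f\<close> all positions of the alternating pattern would carry
    \<open>e\<close>, but only two positions do.\<close>
  then show "e \<noteq> f"
  proof -
    obtain p q h where "R ! p = (e, h)"
      and "\<And>i. i < length R \<Longrightarrow> fst (R ! i) = e \<longleftrightarrow> i = p \<or> i = q"
      by (rule end_positions[OF \<open>e \<in> E\<close>], rule that)
    note this(2)[of i] this(2)[of j] this(2)[of k]
    then show "e \<noteq> f" using * by auto
  qed
qed

text \<open>A loop has exactly one end between the two ends of \<open>e\<close> iff it is interlaced with \<open>e\<close>;
  otherwise it has none or both there, and contributes nothing modulo 2.\<close>

lemma sum_between_ends:
  fixes X :: "'e \<Rightarrow> bit"
  assumes pq: "p < q" "q < length R" "fst (R ! p) = e" "fst (R ! q) = e"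
  shows "(\<Sum>j\<in>{p<..<q}. X (fst (R ! j))) = (\<Sum>f | f \<in> E \<and> interlaced B e f. X f)"
proof -
  have mem: "fst (R ! i) \<in> E" if "i < length R" for i
    using setR nth_mem[OF that] by auto
  have eE: "e \<in> E" using mem[of q] pq by simp
  have occ_e: "fst (R ! i) = e \<longleftrightarrow> i = p \<or> i = q" if "i < length R" for i
  proof -
    obtain a b h where "R ! a = (e, h)" and ab: "\<And>i. i < length R \<Longrightarrow> fst (R ! i) = e \<longleftrightarrow> i = a \<or> i = b"
      by (rule end_positions[OF eE], rule that)
    show ?thesis using ab[OF that] ab[of p] ab[of q] pq by auto
  qed
  \<comment> \<open>The positions strictly between the ends of \<open>e\<close> are grouped by edge;
    this is the contribution of a single edge \<open>f\<close>.\<close>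
  have inner: "(\<Sum>j | j \<in> {p<..<q} \<and> fst (R ! j) = f. X (fst (R ! j))) =
      (if interlaced B e f then X f else 0)" if f: "f \<in> E" for f
  proof (cases "f = e")
    case True
    have "{j. j \<in> {p<..<q} \<and> fst (R ! j) = f} = {}"
      using occ_e pq True by auto
    then show ?thesis using True interlaced_edges(3) by (metis sum.empty)
  next
    case False
    obtain r s h where "r < s" "s < length R"
      and occ_f: "\<And>i. i < length R \<Longrightarrow> fst (R ! i) = f \<longleftrightarrow> i = r \<or> i = s"
      by (rule end_positions[OF f], rule that)
    then have rs: "r < s" "s < length R" "fst (R ! r) = f" "fst (R ! s) = f" by auto
    have ne: "r \<noteq> p" "r \<noteq> q" "s \<noteq> p" "s \<noteq> q" using rs pq False by auto
    \<comment> \<open>Since each edge has only two positions, alternation means that exactly one of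
      \<open>r\<close>, \<open>s\<close> lies between \<open>p\<close> and \<open>q\<close>.\<close>
    have il: "interlaced B e f \<longleftrightarrow> (p < r \<and> r < q \<and> q < s) \<or> (r < p \<and> p < s \<and> s < q)"
    proof
      assume "interlaced B e f"
      then obtain i j k l where *: "i < j" "j < k" "k < l" "l < length R"
        and alt: "fst (R ! i) = e \<and> fst (R ! j) = f \<and> fst (R ! k) = e \<and> fst (R ! l) = f \<or>
         fst (R ! i) = f \<and> fst (R ! j) = e \<and> fst (R ! k) = f \<and> fst (R ! l) = e"
        unfolding interlaced_iff by blast
      then have "i < length R" "j < length R" "k < length R" by auto
      from alt show "(p < r \<and> r < q \<and> q < s) \<or> (r < p \<and> p < s \<and> s < q)"
      proof
        assume "fst (R ! i) = e \<and> fst (R ! j) = f \<and> fst (R ! k) = e \<and> fst (R ! l) = f"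
        then have "i = p \<or> i = q" "k = p \<or> k = q" "j = r \<or> j = s" "l = r \<or> l = s"
          using occ_e occ_f * \<open>i < length R\<close> \<open>j < length R\<close> \<open>k < length R\<close> by blast+
        then have "i = p" "k = q" "j = r" "l = s" using * pq(1) rs(1) by linarith+
        then show ?thesis using * by simp
      next
        assume "fst (R ! i) = f \<and> fst (R ! j) = e \<and> fst (R ! k) = f \<and> fst (R ! l) = e"
        then have "i = r \<or> i = s" "k = r \<or> k = s" "j = p \<or> j = q" "l = p \<or> l = q"
          using occ_e occ_f * \<open>i < length R\<close> \<open>j < length R\<close> \<open>k < length R\<close> by blast+
        then have "i = r" "k = s" "j = p" "l = q" using * pq(1) rs(1) by linarith+
        then show ?thesis using * by simp
      qed
    next
      assume "(p < r \<and> r < q \<and> q < s) \<or> (r < p \<and> p < s \<and> s < q)"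
      then show "interlaced B e f"
        using pq rs unfolding interlaced_iff by blast
    qed
    have set: "{j. j \<in> {p<..<q} \<and> fst (R ! j) = f} = {r, s} \<inter> {p<..<q}"
    proof (rule set_eqI)
      fix j
      have "j \<in> {p<..<q} \<Longrightarrow> j < length R" using pq(2) by simp
      then show "j \<in> {j. j \<in> {p<..<q} \<and> fst (R ! j) = f} \<longleftrightarrow> j \<in> {r, s} \<inter> {p<..<q}"
        using occ_f[of j] by blast
    qed
    have "(\<Sum>j | j \<in> {p<..<q} \<and> fst (R ! j) = f. X (fst (R ! j))) = (\<Sum>j\<in>{r, s} \<inter> {p<..<q}. X f)"
      unfolding set by (rule sum.cong) (use rs in auto)
    also have "\<dots> = (if interlaced B e f then X f else 0)"
      using il rs(1) ne pq(1) by (auto simp: Int_insert_left)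
    finally show ?thesis .
  qed
  have "(\<Sum>j\<in>{p<..<q}. X (fst (R ! j))) =
      (\<Sum>f\<in>E. \<Sum>j | j \<in> {p<..<q} \<and> fst (R ! j) = f. X (fst (R ! j)))"
  proof -
    have "(\<lambda>j. fst (R ! j)) ` {p<..<q} \<subseteq> E"
      using mem pq(2) by (intro image_subsetI) simp
    from sum.group[OF finite_greaterThanLessThan finE this, of "\<lambda>j. X (fst (R ! j))"]
    show ?thesis by (rule sym)
  qed
  also have "\<dots> = (\<Sum>f\<in>E. if interlaced B e f then X f else 0)"
    by (rule sum.cong) (use inner in auto)
  also have "\<dots> = (\<Sum>f | f \<in> E \<and> interlaced B e f. X f)"
    using finE by (simp add: sum.If_cases Int_def)
  finally show ?thesis .
qed

text \<open>Prefix sums will be colours around the vertex. From just before the first end of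
  \<open>e\<close> to just before the second, one crosses \<open>e\<close> itself and then
  everything in between.\<close>

lemma sum_up_to_second_end:
  fixes X :: "'e \<Rightarrow> bit"
  assumes pq: "p < q" "q < length R" "fst (R ! p) = e" "fst (R ! q) = e"
  shows "(\<Sum>j<q. X (fst (R ! j))) =
    (\<Sum>j<p. X (fst (R ! j))) + X e + (\<Sum>f | f \<in> E \<and> interlaced B e f. X f)"
proof -
  let ?g = "\<lambda>j. X (fst (R ! j))"
  have "sum ?g {..<q} = sum ?g {..<Suc p} + sum ?g {Suc p..<q}"
    using pq(1) by (simp add: sum.atLeastLessThan_concat lessThan_atLeast0 del: sum.lessThan_Suc sum.op_ivl_Suc)
  also have "sum ?g {..<Suc p} = sum ?g {..<p} + X e"
    using pq(3) by simp
  finally show ?thesis using sum_between_ends[OF pq, of X] by (simp add: atLeastSucLessThan_greaterThanLessThan)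
qed

text \<open>Every edge is met twice in a full turn, so all terms cancel. This is the closing
  condition for a colouring built from prefix sums.\<close>

lemma sum_all_ends:
  fixes X :: "'e \<Rightarrow> bit"
  shows "(\<Sum>j<length R. X (fst (R ! j))) = 0"
proof -
  have "(\<Sum>j<length R. X (fst (R ! j))) = (\<Sum>x\<leftarrow>R. X (fst x))"
    by (simp add: sum_list_sum_nth atLeast0LessThan)
  also have "\<dots> = (\<Sum>x\<in>E \<times> (UNIV :: bool set). X (fst x))"
    using dist setR by (simp add: sum_list_distinct_conv_sum_set)
  also have "\<dots> = (\<Sum>e\<in>E. \<Sum>h\<in>(UNIV :: bool set). X e)"
    unfolding sum.cartesian_product by (rule sum.cong) auto
  also have "\<dots> = 0" by (simp add: UNIV_bool)
  finally show ?thesis .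
qed

section \<open>Boundary colourings and kernel vectors\<close>

definition boundary_rel :: "(('e \<times> bool) \<times> bool) rel" where
  "boundary_rel = vertex_arcs B \<union> (vertex_arcs B)\<inverse> \<union> ribbon_sides B"

text \<open>Ribbon sides need no added converse: traversing a side twice swaps the end twice and
  flips the corner twice or never.\<close>

lemma sym_boundary_rel: "sym boundary_rel"
proof (rule symI)
  fix x y assume "(x, y) \<in> boundary_rel"
  then consider "(x, y) \<in> vertex_arcs B \<union> (vertex_arcs B)\<inverse>" | "(x, y) \<in> ribbon_sides B"
    by (auto simp: boundary_rel_def)
  then show "(y, x) \<in> boundary_rel"
  proof cases
    case 2
    then obtain e h s where "e \<in> rg_edges B"
      "x = ((e, h), s)" "y = ((e, \<not> h), if e \<in> rg_twisted B then s else \<not> s)"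
      by (auto simp: ribbon_sides_def)
    then have "(y, x) \<in> ribbon_sides B"
      unfolding ribbon_sides_def
      by (intro CollectI exI[of _ e] exI[of _ "\<not> h"] exI[of _ "if e \<in> rg_twisted B then s else \<not> s"]) auto
    then show ?thesis by (simp add: boundary_rel_def)
  qed (auto simp: boundary_rel_def)
qed

lemma vertex_arcs_eq:
  "vertex_arcs B = {((R ! i, True), (R ! (Suc i mod length R), False)) | i. i < length R}"
  by (auto simp: vertex_arcs_def verts rot)

lemma boundary_rel_corners: "boundary_rel \<subseteq> corners B \<times> corners B"
proof -
  have mem: "R ! i \<in> E \<times> UNIV" if "i < length R" for i
    using setR nth_mem[OF that] by auto
  have "vertex_arcs B \<subseteq> corners B \<times> corners B"
  proof
    fix z assume "z \<in> vertex_arcs B"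
    then obtain i where i: "i < length R" "z = ((R ! i, True), (R ! (Suc i mod length R), False))"
      by (auto simp: vertex_arcs_eq)
    then have "Suc i mod length R < length R" by (intro mod_less_divisor) auto
    then show "z \<in> corners B \<times> corners B"
      using i mem[of i] mem[of "Suc i mod length R"] by (simp add: corners_def edges mem_Times_iff)
  qed
  moreover have "ribbon_sides B \<subseteq> corners B \<times> corners B"
    by (auto simp: ribbon_sides_def corners_def)
  ultimately show ?thesis by (auto simp: boundary_rel_def)
qed

lemma boundary_colourings:
  "c \<in> colourings (corners B) boundary_rel \<longleftrightarrow>
    (\<forall>e h s. e \<notin> E \<longrightarrow> c ((e, h), s) = 0) \<and>
    (\<forall>i<length R. c (R ! i, True) = c (R ! (Suc i mod length R), False)) \<and>
    (\<forall>e\<in>E. \<forall>h s. c ((e, h), s) = c ((e, \<not> h), if e \<in> rg_twisted B then s else \<not> s))"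
proof -
  have "c \<in> colourings (corners B) boundary_rel \<longleftrightarrow> (\<forall>x. x \<notin> corners B \<longrightarrow> c x = 0) \<and>
      (\<forall>(x, y)\<in>vertex_arcs B. c x = c y) \<and> (\<forall>(x, y)\<in>ribbon_sides B. c x = c y)"
    unfolding colourings_def boundary_rel_def by fastforce
  moreover have "(\<forall>x. x \<notin> corners B \<longrightarrow> c x = 0) \<longleftrightarrow> (\<forall>e h s. e \<notin> E \<longrightarrow> c ((e, h), s) = 0)"
    by (auto simp: corners_def edges)
  moreover have "(\<forall>(x, y)\<in>vertex_arcs B. c x = c y) \<longleftrightarrow>
      (\<forall>i<length R. c (R ! i, True) = c (R ! (Suc i mod length R), False))"
    unfolding vertex_arcs_eq by blast
  moreover have "(\<forall>(x, y)\<in>ribbon_sides B. c x = c y) \<longleftrightarrow>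
      (\<forall>e\<in>E. \<forall>h s. c ((e, h), s) = c ((e, \<not> h), if e \<in> rg_twisted B then s else \<not> s))"
    unfolding ribbon_sides_def edges by blast
  ultimately show ?thesis by (simp only:)
qed

text \<open>The vector \<open>X\<close> attached to a colouring. It is read off at the end
  \<open>False\<close>; for boundary colourings the other end gives the same value.\<close>

definition jump :: "(('e \<times> bool) \<times> bool \<Rightarrow> bit) \<Rightarrow> 'e \<Rightarrow> bit" where
  "jump c e = (if e \<in> E then c ((e, False), False) + c ((e, False), True) else 0)"

text \<open>Colours are constant along vertex arcs and change by the jump across each ribbon end, so
  walking from position 0 determines all of them.\<close>

lemma colouring_eq:
  assumes c: "c \<in> colourings (corners B) boundary_rel" and i: "i < length R"
  shows "c (R ! i, s) = c (R ! 0, False) + (\<Sum>j<i. jump c (fst (R ! j))) +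
    (if s then jump c (fst (R ! i)) else 0)"
proof -
  have arc: "c (R ! i, True) = c (R ! (Suc i mod length R), False)" if "i < length R" for i
    using c that unfolding boundary_colourings by blast
  have side: "c ((e, h), s) = c ((e, \<not> h), if e \<in> rg_twisted B then s else \<not> s)" if "e \<in> E" for e h s
    using c that unfolding boundary_colourings by blast
  \<comment> \<open>The two sides carry the same pair of colours to both ends, possibly in swapped
    order, so their sum does not depend on the end.\<close>
  have jump: "c (R ! i, True) = c (R ! i, False) + jump c (fst (R ! i))" if "i < length R" for i
  proof -
    obtain e h where eh: "R ! i = (e, h)" by fastforce
    then have "e \<in> E" using nth_mem[OF that] setR by auto
    then have "jump c e = c ((e, h), False) + c ((e, h), True)"
      using side[of e False False] side[of e False True]
      by (cases h) (auto simp: jump_def ac_simps split: if_splits)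
    then show ?thesis using eh by simp
  qed
  have "c (R ! i, False) = c (R ! 0, False) + (\<Sum>j<i. jump c (fst (R ! j)))"
    using i
  proof (induction i)
    case (Suc i)
    then show ?case using jump[of i] arc[of i] by (simp add: add.assoc)
  qed simp
  then show ?thesis using jump[OF i] by simp
qed

text \<open>Equality of the colours at the two ends of one side of \<open>e\<close>, expressed by
  walking around the vertex, is row \<open>e\<close> of the kernel equations.\<close>

lemma jump_in_kernel:
  assumes c: "c \<in> colourings (corners B) boundary_rel"
  shows "jump c \<in> twisted_kernel E (interlaced B) (rg_twisted B)"
  unfolding twisted_kernel_def
proof (intro CollectI conjI ballI allI impI)
  fix e assume e: "e \<in> E"
  obtain p q h where pq: "p < q" "q < length R" "R ! p = (e, h)" "R ! q = (e, \<not> h)"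
    by (rule end_positions[OF e])
  \<comment> \<open>An untwisted side arrives at the second corner of position \<open>q\<close>,
    whose extra jump cancels the \<open>jump c e\<close> of the prefix sum. A twisted one arrives at
    the first corner, so that term survives as the diagonal entry.\<close>
  have "c ((e, h), False) = c ((e, \<not> h), if e \<in> rg_twisted B then False else \<not> False)"
    using c e unfolding boundary_colourings by blast
  then have "c (R ! p, False) = c (R ! q, if e \<in> rg_twisted B then False else True)"
    using pq by simp
  moreover have "(\<Sum>j<q. jump c (fst (R ! j))) = (\<Sum>j<p. jump c (fst (R ! j))) + jump c e +
      (\<Sum>f | f \<in> E \<and> interlaced B e f. jump c f)"
    by (rule sum_up_to_second_end) (use pq in auto)
  moreover have "p < length R" using pq by simp
  ultimately show "(\<Sum>f | f \<in> E \<and> interlaced B e f. jump c f) +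
      (if e \<in> rg_twisted B then jump c e else 0) = 0"
    using colouring_eq[OF c, of p False] colouring_eq[OF c pq(2)] pq
    by (auto simp: ac_simps split: if_splits)
qed (simp add: jump_def)

text \<open>Prefix sums of \<open>X\<close>, started at \<open>b\<close>, define the colouring. Arcs
  agree by construction except for the closing one; sides agree by the kernel equations.\<close>

lemma colouring_from_kernel:
  fixes b :: bit
  assumes X: "X \<in> twisted_kernel E (interlaced B) (rg_twisted B)" and "E \<noteq> {}"
  obtains c where "c \<in> colourings (corners B) boundary_rel" "c (R ! 0, False) = b" "jump c = X"
proof -
  define S where "S i = (\<Sum>j<i. X (fst (R ! j)))" for i
  define pos where "pos = the_inv_into {..<length R} ((!) R)"
  have pos: "pos (R ! i) = i" if "i < length R" for i
    unfolding pos_def using that dist by (intro the_inv_into_f_f) (auto intro: inj_on_nth)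
  define c where "c x = (if fst (fst x) \<in> E
      then b + S (pos (fst x)) + (if snd x then X (fst (fst x)) else 0) else 0)" for x
  have mem: "fst (R ! i) \<in> E" if "i < length R" for i
    using setR nth_mem[OF that] by auto
  have c_nth: "c (R ! i, s) = b + S i + (if s then X (fst (R ! i)) else 0)" if "i < length R" for i s
    using that mem pos by (simp add: c_def)
  have nonempty: "0 < length R" using \<open>E \<noteq> {}\<close> by (rule length_pos)
  have "c \<in> colourings (corners B) boundary_rel"
    unfolding boundary_colourings
  proof (intro conjI allI impI ballI)
    fix e h s assume "e \<notin> E" then show "c ((e, h), s) = 0" by (simp add: c_def)
  next
    fix i assume i: "i < length R"
    show "c (R ! i, True) = c (R ! (Suc i mod length R), False)"
    \<comment> \<open>The last arc returns to position 0, so it needs the total of all jumps to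
      vanish.\<close>
    proof (cases "Suc i = length R")
      case True
      then have "S (Suc i) = 0" using sum_all_ends[of X] by (simp only: S_def)
      then have "S i + X (fst (R ! i)) = 0" by (simp add: S_def del: bit_add_eq_0_iff)
      moreover have "S 0 = 0" by (simp add: S_def)
      ultimately show ?thesis
        using True c_nth[OF i, of True] c_nth[OF nonempty, of False]
        by (simp add: add.assoc del: bit_add_eq_0_iff)
    next
      case False
      then show ?thesis using i by (simp add: c_nth S_def add.assoc)
    qed
  next
    fix e h s assume e: "e \<in> E"
    obtain p q h' where pq: "p < q" "q < length R" "R ! p = (e, h')" "R ! q = (e, \<not> h')"
      by (rule end_positions[OF e])
    have "S q = S p + X e + (\<Sum>f | f \<in> E \<and> interlaced B e f. X f)"
      unfolding S_def by (rule sum_up_to_second_end) (use pq in auto)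
    moreover have "(\<Sum>f | f \<in> E \<and> interlaced B e f. X f) = (if e \<in> rg_twisted B then X e else 0)"
      using X e by (auto simp: twisted_kernel_def)
    ultimately have Sq: "S q = S p + (if e \<in> rg_twisted B then 0 else X e)"
      by (auto simp: add.assoc)
    have side: "c ((e, h'), s) = c ((e, \<not> h'), if e \<in> rg_twisted B then s else \<not> s)" for s
      using c_nth[of p] c_nth[of q] pq Sq by (auto simp: ac_simps)
    \<comment> \<open>For the other value of \<open>h\<close> the same sides are read backwards,
      starting from corner \<open>s\<close> or \<open>\<not> s\<close>.\<close>
    then show "c ((e, h), s) = c ((e, \<not> h), if e \<in> rg_twisted B then s else \<not> s)"
      using side[of s] side[of "\<not> s"] by (cases "h = h'") (auto split: if_splits)
  qed
  moreover have "c (R ! 0, False) = b" using c_nth[OF nonempty] by (simp add: S_def)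
  moreover have "jump c = X"
  proof
    fix e show "jump c e = X e"
      using X by (auto simp: jump_def c_def twisted_kernel_def ac_simps)
  qed
  ultimately show ?thesis by (rule that)
qed

text \<open>A colouring is determined by one start colour and its jumps, and both are free. The
  factor 2 is the 1 in \<open>f = 1 + dim ker (A + D)\<close>.\<close>

lemma card_boundary_colourings:
  assumes "E \<noteq> {}"
  shows "card (colourings (corners B) boundary_rel) =
    2 * card (twisted_kernel E (interlaced B) (rg_twisted B))"
proof -
  let ?K = "twisted_kernel E (interlaced B) (rg_twisted B)"
  let ?C = "colourings (corners B) boundary_rel"
  let ?f = "\<lambda>c. (c (R ! 0, False), jump c)"
  have inj: "inj_on ?f ?C"
  proof (rule inj_onI)
    fix c d assume cd: "c \<in> ?C" "d \<in> ?C" "?f c = ?f d"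
    show "c = d"
    proof
      fix x :: "('e \<times> bool) \<times> bool"
      obtain e h s where x: "x = ((e, h), s)" by (metis prod.exhaust)
      show "c x = d x"
      proof (cases "e \<in> E")
        case True
        then have "(e, h) \<in> set R" using setR by simp
        then obtain i where "i < length R" "R ! i = (e, h)" by (auto simp: in_set_conv_nth)
        then show ?thesis
          using colouring_eq[OF cd(1), of i s] colouring_eq[OF cd(2), of i s] cd(3) x by simp
      next
        case False
        then have "c x = 0" "d x = 0"
          using cd x unfolding boundary_colourings by blast+
        then show ?thesis by simp
      qed
    qed
  qed
  have img: "?f ` ?C = UNIV \<times> ?K"
  proof (intro equalityI subsetI)
    fix y assume "y \<in> (UNIV :: bit set) \<times> ?K"
    then obtain b X where y: "y = (b, X)" "X \<in> ?K" by auto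
    obtain c where "c \<in> ?C" "c (R ! 0, False) = b" "jump c = X"
      by (rule colouring_from_kernel[OF y(2) assms])
    then show "y \<in> ?f ` ?C" using y by force
  qed (use jump_in_kernel in auto)
  have "card ?C = card ((UNIV :: bit set) \<times> ?K)"
    using card_image[OF inj] unfolding img by (rule sym)
  moreover have "card (UNIV :: bit set) = 2"
    unfolding card_2_iff by (rule exI[of _ 0], rule exI[of _ 1]) (auto intro: bit.exhaust)
  ultimately show ?thesis by (simp add: card_cartesian_product)
qed

section \<open>The Euler genus as a rank\<close>

lemma euler_genus_eq:
  assumes "E \<noteq> {}" and "card (twisted_kernel E (interlaced B) (rg_twisted B)) = 2 ^ k"
  shows "euler_genus B = int (card E) - int k"
proof -
  \<comment> \<open>A nonempty word means that no circle of an isolated vertex is added to the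
    count.\<close>
  have "R \<noteq> []" using length_pos[OF assms(1)] by simp
  then have "num_boundary_components B = card (corners B // boundary_rel\<^sup>*)"
    by (simp add: num_boundary_components_def boundary_rel_def verts rot)
  moreover have "finite (corners B)" using finE by (simp add: corners_def edges)
  ultimately have "2 ^ num_boundary_components B = card (colourings (corners B) boundary_rel)"
    using card_colourings[OF _ boundary_rel_corners sym_boundary_rel] by simp
  also have "\<dots> = 2 ^ Suc k" using card_boundary_colourings assms by simp
  finally have "num_boundary_components B = Suc k" by (simp del: power_Suc)
  moreover have "num_components B = 1"
    by (simp add: num_components_def verts quotient_def)
  ultimately show ?thesis by (simp add: euler_genus_def verts edges)
qed

text \<open>Twice the cardinality is the number of boundary colourings, a power of 2, and divisors
  of a power of the prime 2 are again such powers.\<close>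

lemma card_twisted_kernel_power:
  assumes "E \<noteq> {}"
  obtains k where "card (twisted_kernel E (interlaced B) (rg_twisted B)) = 2 ^ k"
proof -
  let ?K = "twisted_kernel E (interlaced B) (rg_twisted B)"
  have fin: "finite (corners B)" using finE by (simp add: corners_def edges)
  have "2 * card ?K = 2 ^ card (corners B // boundary_rel\<^sup>*)"
    by (rule trans[OF card_boundary_colourings[OF assms, symmetric]
      card_colourings[OF fin boundary_rel_corners sym_boundary_rel]])
  from dvd_triv_right[of "card ?K" 2, unfolded this] obtain k where "card ?K = 2 ^ k"
    unfolding divides_primepow_nat[OF two_is_prime_nat] by blast
  then show ?thesis by (rule that)
qed

end

lemma bouquet_word_bouquet:
  assumes "bouquet B"
  obtains v where "bouquet_word B v (rg_rot B v) (rg_edges B)"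
proof -
  obtain v where "rg_verts B = {v}"
    using assms by (auto simp: bouquet_def card_1_singleton_iff)
  then have "bouquet_word B v (rg_rot B v) (rg_edges B)"
    using assms by unfold_locales (auto simp: bouquet_def is_ribbon_graph_def)
  then show ?thesis by (rule that)
qed


subsection \<open>Partial Petrial polynomials\<close>

lemma coeff_sum_monom:
  assumes "finite S"
  shows "coeff (\<Sum>x\<in>S. monom (1::int) (d x)) i = int (card {x\<in>S. d x = i})"
proof -
  have "int (card {x\<in>S. d x = i}) = (\<Sum>x\<in>{x\<in>S. d x = i}. 1)" by simp
  also have "\<dots> = (\<Sum>x\<in>S. if d x = i then 1 else 0)"
    by (rule sum.inter_filter[OF assms])
  finally show ?thesis by (simp add: coeff_sum)
qed

lemma sum_monom_full_support_iff:
  fixes d :: "'b \<Rightarrow> nat"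
  assumes fin: "finite S"
  shows "(\<exists>a :: nat \<Rightarrow> int. (\<Sum>x\<in>S. monom 1 (d x)) = (\<Sum>i = 1..n. monom (a i) i) \<and>
    (\<forall>i\<in>{1..n}. a i \<noteq> 0)) \<longleftrightarrow> d ` S = {1..n}"
    (is "?L \<longleftrightarrow> ?R")
proof -
  let ?p = "\<Sum>x\<in>S. monom (1::int) (d x)"
  have coeff_a: "coeff (\<Sum>i = 1..n. monom (a i) i) j = (if j \<in> {1..n} then a j else 0)"
    for a :: "nat \<Rightarrow> int" and j
    by (simp add: coeff_sum coeff_monom)
  have coeff_p: "coeff ?p j \<noteq> 0 \<longleftrightarrow> j \<in> d ` S" for j
    using fin by (auto simp: coeff_sum_monom)
  show ?thesis
  proof
    assume ?L
    then obtain a :: "nat \<Rightarrow> int" where a: "?p = (\<Sum>i = 1..n. monom (a i) i)" "\<forall>i\<in>{1..n}. a i \<noteq> 0"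
      by blast
    have "j \<in> d ` S \<longleftrightarrow> j \<in> {1..n}" for j
      using coeff_p[of j] coeff_a[of a j] a by (simp del: atLeastAtMost_iff split: if_splits)
    then show ?R by blast
  next
    assume R: ?R
    have "?p = (\<Sum>i = 1..n. monom (coeff ?p i) i)"
      by (rule poly_eqI) (use coeff_p R in \<open>auto simp only: coeff_a split: if_splits\<close>)
    moreover have "\<forall>i\<in>{1..n}. coeff ?p i \<noteq> 0" using coeff_p R by blast
    ultimately show ?L by (intro exI[of _ "coeff ?p"] conjI)
  qed
qed

section \<open>Attained genera and completeness of the intersection graph\<close>

theorem theorem3p5:
  fixes G :: "'a pair_pre_digraph" and n :: nat
  assumes "circle_graph G"
    and "Digraph_Component.connected (with_proj G)"
    and "card (pverts G) = n"
    and "n \<ge> 2"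
  shows "(\<exists>a :: nat \<Rightarrow> int. circle_graph_poly G = (\<Sum>i = 1..n. monom (a i) i) \<and> (\<forall>i\<in>{1..n}. a i \<noteq> 0))
    \<longleftrightarrow> complete_digraph n (with_proj G)"
proof -
  \<comment> \<open>The bouquet chosen inside \<open>circle_graph_poly\<close>; what is used of it
    is that it represents \<open>G\<close>.\<close>
  define B where "B = (SOME B. represents B G)"
  have "represents B G"
    using assms(1) unfolding B_def circle_graph_def by (rule someI_ex)
  then have bq: "bouquet B" and G: "G = intersection_graph B"
    by (simp_all add: represents_def)
  define E T I where "E = rg_edges B" and "T = rg_twisted B" and "I = interlaced B"
  have E_G: "pverts G = E" and arcs_G: "parcs G = {(e, f). I e f}"
    by (simp_all add: G intersection_graph_def E_def I_def)
  have cardE: "card E = n" using assms(3) E_G by simp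
  have finE: "finite E" using cardE \<open>n \<ge> 2\<close> by (metis card.infinite not_numeral_le_zero)
  have "E \<noteq> {}" using cardE \<open>n \<ge> 2\<close> by auto
  have TE: "T \<subseteq> E" using bq by (simp add: bouquet_def is_ribbon_graph_def E_def T_def)
  have I_edges: "e \<in> E \<and> f \<in> E \<and> e \<noteq> f" if "I e f" for e f
  proof -
    obtain v where "bouquet_word B v (rg_rot B v) (rg_edges B)" by (rule bouquet_word_bouquet[OF bq])
    from bouquet_word.interlaced_edges[OF this] show ?thesis using that by (simp add: I_def E_def)
  qed
  have I_sym: "I f e" if "I e f" for e f using that interlaced_sym[of B e f] by (simp add: I_def)
  define g where "g A = nat (euler_genus (partial_petrial B A))" for A
  define K where "K A = twisted_kernel E I ((T - A) \<union> (A - T))" for A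
  \<comment> \<open>The partial Petrial toggles twists, so its diagonal is the symmetric difference
    of \<open>T\<close> and \<open>A\<close>, and \<open>g A\<close> is the rank of the resulting
    matrix.\<close>
  have genus: "\<exists>k. card (K A) = 2 ^ k \<and> g A = n - k" if "A \<subseteq> E" for A
  proof -
    have "bouquet (partial_petrial B A)"
      using bouquet_partial_petrial[OF bq] that by (simp add: E_def)
    then obtain v where bw: "bouquet_word (partial_petrial B A) v (rg_rot (partial_petrial B A) v) E"
      by (rule bouquet_word_bouquet) (simp add: E_def)
    have K: "K A = twisted_kernel E (interlaced (partial_petrial B A)) (rg_twisted (partial_petrial B A))"
      unfolding K_def I_def T_def interlaced_partial_petrial by (simp add: partial_petrial_def)
    obtain k where k: "card (K A) = 2 ^ k"
      unfolding K by (rule bouquet_word.card_twisted_kernel_power[OF bw \<open>E \<noteq> {}\<close>])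
    moreover have "g A = n - k"
      using bouquet_word.euler_genus_eq[OF bw \<open>E \<noteq> {}\<close> k[unfolded K]] cardE by (simp add: g_def)
    ultimately show ?thesis by blast
  qed
  have poly: "circle_graph_poly G = (\<Sum>A\<in>Pow E. monom 1 (g A))"
    by (simp add: circle_graph_poly_def partial_petrial_poly_def B_def E_def g_def)
  have complete: "complete_digraph n (with_proj G) \<longleftrightarrow> (\<forall>e\<in>E. \<forall>f\<in>E. e \<noteq> f \<longrightarrow> I e f)"
    using finE cardE I_edges by (auto simp: complete_digraph_pair_def E_G arcs_G set_eq_iff)
  have "g ` Pow E = {1..n} \<longleftrightarrow> complete_digraph n (with_proj G)"
  proof
    assume "g ` Pow E = {1..n}"
    then have "1 \<in> g ` Pow E" using \<open>n \<ge> 2\<close> by simp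
    then obtain A where A: "A \<subseteq> E" "g A = 1" by force
    obtain k where "card (K A) = 2 ^ k" "g A = n - k" using genus A by blast
    \<comment> \<open>As \<open>g A = 1\<close> is nonzero, the natural subtraction
      \<open>n - k\<close> is not truncated and \<open>k = n - 1\<close>.\<close>
    then have cardK: "card (K A) = 2 ^ (n - 1)" using A \<open>n \<ge> 2\<close> by (metis diff_diff_cancel diff_is_0_eq' le_cases one_neq_zero)
    \<comment> \<open>A failure of transitivity is an induced path, which would force rank at least
      2 against the rank 1 of this \<open>A\<close>.\<close>
    have trans: "I u w" if "I u v" "I v w" "u \<noteq> w" for u v w
    proof (rule ccontr)
      assume "\<not> I u w"
      then have "card (K A) \<le> 2 ^ (n - 2)"
        unfolding K_def cardE[symmetric]
        by (intro card_twisted_kernel_induced_path[where u = u and v = v and w = w])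
          (use that finE I_edges in blast)+
      moreover have "(2::nat) ^ (n - 2) < 2 ^ (n - 1)" using \<open>n \<ge> 2\<close> by simp
      ultimately show False using cardK by simp
    qed
    have "I u w" if "u \<in> E" "w \<in> E" "u \<noteq> w" for u w
    proof -
      have "u \<rightarrow>\<^sup>*\<^bsub>with_proj (mk_symmetric (with_proj G))\<^esub> w"
        using assms(2) that E_G by (simp add: connected_def strongly_connected_def)
      then have "(u, w) \<in> (parcs (mk_symmetric (with_proj G)))\<^sup>*"
        by (metis reachable_rtranclI with_proj_simps(3))
      \<comment> \<open>Connectedness is stated for the symmetric closure, which changes nothing
        here; transitivity then shrinks any path to a single edge.\<close>
      moreover have "parcs (mk_symmetric (with_proj G)) = {(e, f). I e f}"
        using I_sym by (auto simp: parcs_mk_symmetric arcs_G)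
      ultimately have "(u, w) \<in> {(e, f). I e f}\<^sup>*" by simp
      then have "u = w \<or> I u w"
        by induction (use trans in blast)+
      then show ?thesis using that by simp
    qed
    then show "complete_digraph n (with_proj G)" using complete by blast
  next
    assume "complete_digraph n (with_proj G)"
    then have I_iff: "I e f \<longleftrightarrow> e \<noteq> f" if "e \<in> E" "f \<in> E" for e f
      using that complete I_edges by blast
    \<comment> \<open>Two distinct vertices give an adjacent pair, which excludes rank 0.\<close>
    obtain u v where uv: "u \<in> E" "v \<in> E" "u \<noteq> v"
      using cardE \<open>n \<ge> 2\<close> by (metis card_le_Suc0_iff_eq finE not_less_eq_eq numeral_2_eq_2)
    show "g ` Pow E = {1..n}"
    proof (intro equalityI subsetI)
      fix i assume "i \<in> g ` Pow E"
      then obtain A where A: "A \<subseteq> E" "i = g A" by auto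
      obtain k where k: "card (K A) = 2 ^ k" "g A = n - k" using genus A by blast
      have "card (K A) \<le> 2 ^ (n - 1)"
        unfolding K_def cardE[symmetric]
        by (rule card_twisted_kernel_adjacent[where u = u and v = v]) (use finE uv I_iff in auto)
      then have "k \<le> n - 1" using k by simp
      then show "i \<in> {1..n}" using k A \<open>n \<ge> 2\<close> by simp
    next
      fix i assume i: "i \<in> {1..n}"
      \<comment> \<open>With \<open>n - i + 1\<close> twisted loops the kernel has dimension
        \<open>n - i\<close>, hence the rank is \<open>i\<close>.\<close>
      then have "n - i + 1 \<le> card E" using cardE by auto
      then obtain U where U: "U \<subseteq> E" "card U = n - i + 1"
        by (rule obtain_subset_with_card_n)
      \<comment> \<open>Toggling the symmetric difference of \<open>T\<close> and \<open>U\<close>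
        makes \<open>U\<close> the set of twisted loops.\<close>
      let ?A = "(T - U) \<union> (U - T)"
      have A: "?A \<subseteq> E" using U TE by auto
      have "(T - ?A) \<union> (?A - T) = U" by auto
      then have "K ?A = twisted_kernel E I U" by (simp only: K_def)
      moreover have "card (twisted_kernel E I U) = 2 ^ (card U - 1)"
        by (rule card_twisted_kernel_complete) (use finE U I_iff in auto)
      ultimately have "card (K ?A) = 2 ^ (n - i)" using U by simp
      moreover obtain k where "card (K ?A) = 2 ^ k" "g ?A = n - k" using genus[OF A] by blast
      ultimately have "g ?A = i" using i by simp
      then show "i \<in> g ` Pow E" using A by blast
    qed
  qed
  then show ?thesis
    unfolding poly using sum_monom_full_support_iff[of "Pow E" g n] finE by simp
qed

end
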